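(* Let $D$ be a digraph whose underlying graph $G_D$ is a perfect graph. Then $D$ is a CKI-digraph if and only if $D\cong \overrightarrow{C}_3$ or $D\cong \overrightarrow{C}_n(1,\pm2,\pm3,\dots,\pm\lfloor \frac{n}{2}\rfloor)$ for some $n\ge4$.
   Context: Digraphs are finite, without loops or parallel arcs; both arcs $uv$ and $vu$ may be present. The underlying graph $G_D$ of $D$ has vertex set $V(D)$, with $\{u,v\}$ an edge iff $uv\in A(D)$ or $vu\in A(D)$. A set $S\subseteq V(D)$ is independent if no arc joins two vertices of $S$, and absorbent if every $u\in V(D)\setminus S$ has an arc $uv$ with $v\in S$. A kernel is an independent absorbent set. $D$ is a CKI-digraph (critical kernel imperfect) if $D$ has no kernel but every proper induced subdigraph of $D$ has a kernel. $\overrightarrow{C}_3$ is the directed cycle on $3$ vertices. For $m\ge2$ and nonempty $J\subseteq\mathbb{Z}_m\setminus\{0\}$, the circulant digraph $\overrightarrow{C}_m(J)$ has vertex set $\mathbb{Z}_m$ and arcs $(i,j)$ with $j-i\in J$; $\overrightarrow{C}_n(1,\pm2,\dots,\pm\lfloor n/2\rfloor)$ means $J=\{1\}\cup\{\pm k: 2\le k\le\lfloor n/2\rfloor\}$. *)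

theory Defs
  imports
    "Graph_Theory.Graph_Theory"
    "HOL-Number_Theory.Cong"
begin

section \<open>Kernels and critical kernel imperfect digraphs\<close>

definition independent_set :: "('a, 'b) pre_digraph \<Rightarrow> 'a set \<Rightarrow> bool" where
  "independent_set D S \<longleftrightarrow> S \<subseteq> verts D \<and> (\<forall>u\<in>S. \<forall>v\<in>S. \<not> u \<rightarrow>\<^bsub>D\<^esub> v)"

definition absorbent_set :: "('a, 'b) pre_digraph \<Rightarrow> 'a set \<Rightarrow> bool" where
  "absorbent_set D S \<longleftrightarrow> S \<subseteq> verts D \<and> (\<forall>u\<in>verts D - S. \<exists>v\<in>S. u \<rightarrow>\<^bsub>D\<^esub> v)"

definition is_kernel :: "('a, 'b) pre_digraph \<Rightarrow> 'a set \<Rightarrow> bool" where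
  "is_kernel D S \<longleftrightarrow> independent_set D S \<and> absorbent_set D S"

definition has_kernel :: "('a, 'b) pre_digraph \<Rightarrow> bool" where
  "has_kernel D \<longleftrightarrow> (\<exists>S. is_kernel D S)"

definition cki_digraph :: "('a, 'b) pre_digraph \<Rightarrow> bool" where
  "cki_digraph D \<longleftrightarrow>
     \<not> has_kernel D \<and> (\<forall>H. induced_subgraph H D \<and> H \<noteq> D \<longrightarrow> has_kernel H)"


section \<open>Perfect graphs\<close>

text \<open>
  Following the library, an undirected graph is a symmetric loop-free digraph (locale
  \<^locale>\<open>graph\<close>); the underlying graph of \<open>D\<close> is \<^term>\<open>mk_symmetric D\<close>. The notions of this
  section are meant for such digraphs only.
\<close>

definition is_clique :: "('a, 'b) pre_digraph \<Rightarrow> 'a set \<Rightarrow> bool" where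
  "is_clique G K \<longleftrightarrow> K \<subseteq> verts G \<and> (\<forall>u\<in>K. \<forall>v\<in>K. u \<noteq> v \<longrightarrow> u \<rightarrow>\<^bsub>G\<^esub> v)"

definition clique_number :: "('a, 'b) pre_digraph \<Rightarrow> nat" where
  "clique_number G = Max (card ` {K. is_clique G K})"

definition is_coloring :: "('a, 'b) pre_digraph \<Rightarrow> nat \<Rightarrow> ('a \<Rightarrow> nat) \<Rightarrow> bool" where
  "is_coloring G k c \<longleftrightarrow>
     (\<forall>v\<in>verts G. c v < k) \<and> (\<forall>u v. u \<rightarrow>\<^bsub>G\<^esub> v \<longrightarrow> c u \<noteq> c v)"

definition chromatic_number :: "('a, 'b) pre_digraph \<Rightarrow> nat" where
  "chromatic_number G = (LEAST k. \<exists>c. is_coloring G k c)"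

definition perfect_graph :: "('a, 'b) pre_digraph \<Rightarrow> bool" where
  "perfect_graph G \<longleftrightarrow>
     (\<forall>H. induced_subgraph H G \<longrightarrow> chromatic_number H = clique_number H)"


section \<open>Circulant digraphs\<close>

text \<open>
  The residues modulo \<open>m\<close> are represented by \<open>0, \<dots>, m - 1\<close>, and \<open>J\<close> by arbitrary integer
  representatives, so that for instance \<open>-k\<close> may be used for the residue \<open>m - k\<close>.
\<close>

definition circulant :: "nat \<Rightarrow> int set \<Rightarrow> int pair_pre_digraph" where
  "circulant m J =
     \<lparr> pverts = {0..<int m},
       parcs = {(i, j). i \<in> {0..<int m} \<and> j \<in> {0..<int m} \<and>
                        (\<exists>k\<in>J. [j - i = k] (mod int m))} \<rparr>"

definition directed_cycle :: "nat \<Rightarrow> int pair_pre_digraph" where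
  "directed_cycle m = circulant m {1}"

text \<open>The jump set \<open>1, \<plusminus>2, \<plusminus>3, \<dots>, \<plusminus>\<lfloor>n/2\<rfloor>\<close>.\<close>

definition jumps_one_pm :: "nat \<Rightarrow> int set" where
  "jumps_one_pm n = {1} \<union> (\<Union>k\<in>{2..int (n div 2)}. {k, - k})"

end

theory Submission
  imports Defs "HOL-Analysis.Analysis"
begin

text \<open>
  Suppose every nonempty clique of the underlying graph contains a vertex absorbing the rest of it. Then
  each clique \<open>K\<close> carries a ranking in which every vertex has arcs to all higher ranked ones. By Brouwer
  there is a function \<open>f\<close> on the vertices with
  \<open>f v = min\<^sub>K max 0 (1 - \<Sum>f u)\<close>, where \<open>K\<close> ranges over the cliques containing \<open>v\<close> and \<open>u\<close> over the
  vertices of \<open>K\<close> ranked above \<open>v\<close>. This is a fractional kernel: all clique sums are at most \<open>1\<close>, and for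
  every \<open>v\<close> some clique has sum \<open>1\<close> over its members ranked at least as high as \<open>v\<close>. Simultaneous
  Diophantine approximation replaces \<open>f\<close> by an integral weight \<open>p\<close> and \<open>1\<close> by some \<open>q\<close>, preserving the
  tight cliques. In a perfect graph \<open>p\<close> is a sum of \<open>q\<close> stable sets, each of which meets all tight cliques
  and is therefore a kernel.

  Hence a CKI-digraph with perfect underlying graph is a clique without absorbing vertex, and
  minimality forces its missing arcs to form a single directed cycle through all vertices.
\<close>

section \<open>Weighted colourings of perfect graphs\<close>

definition clique :: "'a rel \<Rightarrow> 'a set \<Rightarrow> bool" where
  "clique E K \<longleftrightarrow> (\<forall>u\<in>K. \<forall>v\<in>K. u \<noteq> v \<longrightarrow> (u, v) \<in> E)"

definition stable_set :: "'a rel \<Rightarrow> 'a set \<Rightarrow> bool" where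
  "stable_set E S \<longleftrightarrow> (\<forall>u\<in>S. \<forall>v\<in>S. (u, v) \<notin> E)"

text \<open>For finite \<open>V\<close> this says that the chromatic number of every induced
  subgraph is at most its clique number, phrased through upper bounds \<open>k\<close> so that
  neither number has to be formed.\<close>

definition perfect_on :: "'a rel \<Rightarrow> 'a set \<Rightarrow> bool" where
  "perfect_on E V \<longleftrightarrow>
     (\<forall>W\<subseteq>V. \<forall>k. (\<forall>K\<subseteq>W. clique E K \<longrightarrow> card K \<le> k) \<longrightarrow>
        (\<exists>c. (\<forall>v\<in>W. c v < k) \<and> (\<forall>u\<in>W. \<forall>v\<in>W. (u, v) \<in> E \<longrightarrow> c u \<noteq> (c v :: nat))))"

lemma clique_subset: "clique E K \<Longrightarrow> L \<subseteq> K \<Longrightarrow> clique E L"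
  unfolding clique_def by blast

lemma card_clique_Int_stable:
  assumes "clique E K" "stable_set E S" "finite K"
  shows "card (K \<inter> S) \<le> 1"
  using assms by (auto simp: card_le_Suc0_iff_eq clique_def stable_set_def)

text \<open>Double counting of the pairs of an element of \<open>K\<close> and a position in
  \<open>As\<close>; a list allows the same set to occur repeatedly.\<close>

lemma sum_count_members:
  assumes "finite K"
  shows "(\<Sum>v\<in>K. length (filter (\<lambda>A. v \<in> A) As)) = (\<Sum>A\<leftarrow>As. card (K \<inter> A))"
proof (induction As)
  case (Cons A As)
  have "(\<Sum>v\<in>K. length (filter (\<lambda>A. v \<in> A) (A # As))) =
      (\<Sum>v\<in>K. (if v \<in> A then 1 else 0) + length (filter (\<lambda>A. v \<in> A) As))"
    by (rule sum.cong) auto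
  also have "\<dots> = card (K \<inter> A) + (\<Sum>A\<leftarrow>As. card (K \<inter> A))"
    using assms Cons by (simp add: sum.distrib sum.inter_restrict[symmetric])
  finally show ?case by simp
qed simp

lemma sum_list_eq_length:
  fixes f :: "'b \<Rightarrow> nat"
  assumes "\<And>x. x \<in> set xs \<Longrightarrow> f x \<le> 1" and "(\<Sum>x\<leftarrow>xs. f x) = length xs" and "x \<in> set xs"
  shows "f x = 1"
proof -
  have le: "(\<Sum>x\<leftarrow>ys. f x) \<le> length ys" if "set ys \<subseteq> set xs" for ys
    using that assms(1) by (induction ys) force+
  obtain ys zs where xs: "xs = ys @ x # zs"
    using split_list[OF assms(3)] by blast
  have "f x \<ge> 1"
    using le[of ys] le[of zs] assms(2) by (simp add: xs subset_iff)
  with assms(1,3) show ?thesis by (simp add: order_antisym)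
qed

text \<open>By double counting, the numbers \<open>card (K \<inter> A)\<close> add up to
  \<open>length As\<close>. Each is at most 1, as a clique and a stable set share at most one
  vertex, so none can be 0.\<close>

lemma tight_clique_meets_stable:
  assumes "finite K" "clique E K"
    and "\<And>A. A \<in> set As \<Longrightarrow> stable_set E A"
    and "(\<Sum>v\<in>K. length (filter (\<lambda>A. v \<in> A) As)) = length As" "A \<in> set As"
  shows "card (K \<inter> A) = 1"
  using assms
  by (intro sum_list_eq_length[of As "\<lambda>A. card (K \<inter> A)" A] card_clique_Int_stable)
    (simp_all add: sum_count_members)

text \<open>
  If \<open>p v \<ge> 2\<close>, lower the weight of \<open>v\<close> by one and colour. Take a colour class \<open>A\<close> containing \<open>v\<close>: a clique
  that is tight for the lowered weight avoids \<open>v\<close>, so it meets \<open>A - {v}\<close>. Hence \<open>q - 1\<close> colours suffice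
  for the lowered weight minus \<open>A - {v}\<close>, and adding \<open>A\<close> restores the weight \<open>p\<close>.
\<close>

lemma perfect_weighted_coloring:
  fixes p :: "'a \<Rightarrow> nat"
  assumes fin: "finite V" and perf: "perfect_on E V" and irrefl: "\<And>v. (v, v) \<notin> E"
    and "\<And>K. K \<subseteq> V \<Longrightarrow> clique E K \<Longrightarrow> sum p K \<le> q"
  shows "\<exists>As. length As = q \<and> (\<forall>A\<in>set As. stable_set E A) \<and>
    (\<forall>v\<in>V. length (filter (\<lambda>A. v \<in> A) As) = p v)"
  using assms(4)
proof (induction "sum p V" arbitrary: p q rule: less_induct)
  case less
  note bound = less.prems
  have finK: "finite K" if "K \<subseteq> V" for K
    using that fin finite_subset by blast
  show ?case
  proof (cases "\<forall>v\<in>V. p v \<le> 1")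
    case True
    define W where "W = {v \<in> V. p v = 1}"
    have "card K \<le> q" if "K \<subseteq> W" "clique E K" for K
      using bound[of K] that by (simp add: W_def subset_iff)
    then obtain c where c: "\<And>v. v \<in> W \<Longrightarrow> c v < q"
        "\<And>u v. u \<in> W \<Longrightarrow> v \<in> W \<Longrightarrow> (u, v) \<in> E \<Longrightarrow> c u \<noteq> c v"
      using perf unfolding perfect_on_def W_def by (metis (no_types, lifting) mem_Collect_eq subsetI)
    define As where "As = map (\<lambda>i. {v \<in> W. c v = i}) [0..<q]"
    have "length (filter (\<lambda>A. v \<in> A) As) = p v" if "v \<in> V" for v
    proof -
      have "length (filter (\<lambda>A. v \<in> A) As) = card {i. i < q \<and> v \<in> W \<and> c v = i}"
        unfolding As_def
        by (subst length_filter_conv_card) (auto intro!: arg_cong[where f = card])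
      also have "\<dots> = p v"
      proof (cases "v \<in> W")
        case vW: True
        then have "{i. i < q \<and> v \<in> W \<and> c v = i} = {c v}" using c by auto
        with vW show ?thesis by (simp add: W_def)
      next
        case False
        with True that have "p v = 0" by (force simp: W_def)
        with False show ?thesis by simp
      qed
      finally show ?thesis .
    qed
    moreover have "\<forall>A\<in>set As. stable_set E A"
      using c(2) unfolding As_def stable_set_def by fastforce
    ultimately show ?thesis
      by (intro exI[of _ As]) (simp add: As_def)
  next
    case False
    then obtain v where v: "v \<in> V" "p v \<ge> 2" by force
    define p' where "p' = p(v := p v - 1)"
    have p'_Suc: "sum p K = Suc (sum p' K)" if "K \<subseteq> V" "v \<in> K" for K
      using that v finK[OF that(1)] by (simp add: p'_def sum.remove)
    have p'_eq: "sum p K = sum p' K" if "v \<notin> K" for K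
      using that by (auto simp: p'_def intro: sum.cong)
    have less': "sum p' V < sum p V"
      using p'_Suc[of V] v by simp
    have bound': "sum p' K \<le> q" if "K \<subseteq> V" "clique E K" for K
      using bound[OF that] p'_Suc[OF that(1)] p'_eq[of K] by linarith
    obtain As where As: "length As = q" "\<forall>A\<in>set As. stable_set E A"
        "\<And>u. u \<in> V \<Longrightarrow> length (filter (\<lambda>A. u \<in> A) As) = p' u"
      using less.hyps[OF less' bound'] by blast
    have "filter (\<lambda>A. v \<in> A) As \<noteq> []"
      using As(3)[OF v(1)] v(2) by (auto simp: p'_def)
    then obtain A where A: "A \<in> set As" "v \<in> A"
      using filter_False by metis
    have stA: "stable_set E A" using A As by blast
    have q: "q > 0" using A As by (metis length_pos_if_in_set)
    \<comment> \<open>Every vertex of \<open>V\<close> in \<open>A\<close> still has positive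
      weight, so the natural-number subtraction in \<open>p''\<close> is not truncated.\<close>
    have p'_pos: "p' u \<ge> 1" if "u \<in> V" "u \<in> A" for u
    proof -
      have "A \<in> set (filter (\<lambda>B. u \<in> B) As)" using A that by simp
      from length_pos_if_in_set[OF this] show ?thesis using As(3)[OF that(1)] by simp
    qed
    define p'' where "p'' u = (if u \<in> A - {v} then p' u - 1 else p' u)" for u
    have p''_sum: "sum p' K = sum p'' K + card (K \<inter> (A - {v}))" if "K \<subseteq> V" for K
    proof -
      have "p' u = p'' u + (if u \<in> A - {v} then 1 else 0)" if "u \<in> K" for u
      proof -
        have "p' u \<ge> 1" if "u \<in> A"
          using p'_pos that \<open>u \<in> K\<close> \<open>K \<subseteq> V\<close> by blast
        then show ?thesis by (auto simp: p''_def)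
      qed
      then have "sum p' K = (\<Sum>u\<in>K. p'' u + (if u \<in> A - {v} then 1 else 0))"
        by (rule sum.cong[OF refl])
      also have "\<dots> = sum p'' K + card (K \<inter> (A - {v}))"
        using finK[OF that] by (simp add: sum.distrib sum.inter_restrict[symmetric] del: Diff_iff)
      finally show ?thesis .
    qed
    have bound'': "sum p'' K \<le> q - 1" if K: "K \<subseteq> V" "clique E K" for K
    proof (cases "sum p' K = q")
      case True
      have "v \<notin> K" using bound[OF K] p'_Suc[OF K(1)] True by force
      have "(\<Sum>u\<in>K. length (filter (\<lambda>A. u \<in> A) As)) = length As"
        using As True K(1) by (metis (no_types, lifting) subsetD sum.cong)
      then have "card (K \<inter> A) = 1"
        using tight_clique_meets_stable[of K E As A] finK K As A by blast
      moreover have "K \<inter> (A - {v}) = K \<inter> A" using \<open>v \<notin> K\<close> by blast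
      ultimately show ?thesis using p''_sum[OF K(1)] True by simp
    next
      case False
      then show ?thesis using bound'[OF K] p''_sum[OF K(1)] by linarith
    qed
    have less'': "sum p'' V < sum p V"
      using less' p''_sum[of V] by simp
    obtain Bs where Bs: "length Bs = q - 1" "\<forall>A\<in>set Bs. stable_set E A"
        "\<And>u. u \<in> V \<Longrightarrow> length (filter (\<lambda>A. u \<in> A) Bs) = p'' u"
      using less.hyps[OF less'' bound''] by blast
    have "length (filter (\<lambda>A. u \<in> A) (A # Bs)) = p u" if u: "u \<in> V" for u
    proof (cases "u \<in> A")
      case uA: True
      have "p' u \<ge> 1" using p'_pos u uA by blast
      then show ?thesis using Bs(3)[OF u] uA v by (auto simp: p''_def p'_def)
    next
      case False
      then show ?thesis using Bs(3)[OF u] A by (auto simp: p''_def p'_def)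
    qed
    then show ?thesis
      using Bs stA q by (intro exI[of _ "A # Bs"]) auto
  qed
qed

section \<open>Fractional kernels\<close>

text \<open>The dimension is a number, later the number of vertices, so points are sequences and
  only the first \<open>n\<close> coordinates are to be fixed. Kuhn's combinatorial lemma on ever
  finer grids yields small cells in which each coordinate is not decreased at one corner and not
  increased at another; a limit of such cells is fixed.\<close>

lemma brouwer_nat_cube:
  fixes F :: "(nat \<Rightarrow> real) \<Rightarrow> nat \<Rightarrow> real"
  assumes cont: "\<And>i. i < n \<Longrightarrow> continuous_on UNIV (\<lambda>x. F x i)"
    and range: "\<And>x i. i < n \<Longrightarrow> (\<And>j. 0 \<le> x j \<and> x j \<le> 1) \<Longrightarrow> 0 \<le> F x i \<and> F x i \<le> 1"
  obtains x where "\<And>i. 0 \<le> x i \<and> x i \<le> 1" "\<And>i. i < n \<Longrightarrow> F x i = x i"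
proof -
  \<comment> \<open>\<open>e p q\<close> is the grid point \<open>q / p\<close>, clipped at 1 and
    set to 0 from coordinate \<open>n\<close> on, so that it lies in \<open>C\<close> for every
    \<open>q\<close>.\<close>
  define e :: "nat \<Rightarrow> (nat \<Rightarrow> nat) \<Rightarrow> nat \<Rightarrow> real"
    where "e p q = (\<lambda>j. if j < n then min 1 (real (q j) / real p) else 0)" for p q
  define C where "C = {x :: nat \<Rightarrow> real. \<forall>j. 0 \<le> x j \<and> x j \<le> 1}"
  have eC: "e p q \<in> C" for p q by (auto simp: e_def C_def)
  have "\<exists>q. (\<forall>i<n. \<exists>r s. (\<forall>j<n. q j \<le> r j \<and> r j \<le> q j + 1) \<and>
        (\<forall>j<n. q j \<le> s j \<and> s j \<le> q j + 1) \<and>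
        e p r i \<le> F (e p r) i \<and> F (e p s) i \<le> e p s i)" if "p > 0" for p
  proof -
    \<comment> \<open>Label 0 means that \<open>F\<close> does not decrease coordinate
      \<open>i\<close>, label 1 that it does not increase it. The exceptions at 0 and
      \<open>p\<close> supply the boundary labels of Kuhn's lemma; they fit this reading because
      \<open>F\<close> maps into the cube.\<close>
    define label :: "(nat \<Rightarrow> nat) \<Rightarrow> nat \<Rightarrow> nat" where
      "label x i = (if x i = 0 \<or> (x i \<noteq> p \<and> e p x i \<le> F (e p x) i) then 0 else 1)" for x i
    have FC: "0 \<le> F (e p x) i \<and> F (e p x) i \<le> 1" if "i < n" for x i
      using range[OF that, of "e p x"] eC[of p x] by (auto simp: C_def)
    have 0: "e p x i \<le> F (e p x) i" if "i < n" "label x i = 0" for x i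
      using that FC[of i x] by (auto simp: label_def e_def split: if_splits)
    have 1: "F (e p x) i \<le> e p x i" if "i < n" "label x i \<noteq> 0" for x i
      using that FC[of i x] \<open>p > 0\<close> by (auto simp: label_def e_def split: if_splits)
    obtain q where "\<forall>i<n. \<exists>r s. (\<forall>j<n. q j \<le> r j \<and> r j \<le> q j + 1) \<and>
        (\<forall>j<n. q j \<le> s j \<and> s j \<le> q j + 1) \<and> label r i \<noteq> label s i"
      by (rule kuhn_lemma[of p n label]) (use \<open>p > 0\<close> in \<open>auto simp: label_def\<close>)
    moreover have "label r i = 0 \<or> label s i = 0" if "label r i \<noteq> label s i" for r s i
      using that by (auto simp: label_def split: if_splits)
    ultimately have "\<exists>r s. (\<forall>j<n. q j \<le> r j \<and> r j \<le> q j + 1) \<and>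
        (\<forall>j<n. q j \<le> s j \<and> s j \<le> q j + 1) \<and>
        e p r i \<le> F (e p r) i \<and> F (e p s) i \<le> e p s i" if "i < n" for i
      using that 0[OF that] 1[OF that] by metis
    then show ?thesis by blast
  qed
  then obtain q where q: "\<And>p i. p > 0 \<Longrightarrow> i < n \<Longrightarrow>
      \<exists>r s. (\<forall>j<n. q p j \<le> r j \<and> r j \<le> q p j + 1) \<and>
        (\<forall>j<n. q p j \<le> s j \<and> s j \<le> q p j + 1) \<and>
        e p r i \<le> F (e p r) i \<and> F (e p s) i \<le> e p s i"
    by metis
  \<comment> \<open>Tychonoff's theorem makes the cube of sequences compact.\<close>
  have "compactin (product_topology (\<lambda>_. euclidean) UNIV) (PiE UNIV (\<lambda>_::nat. {0..1::real}))"
    by (subst compactin_PiE) simp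
  moreover have "PiE UNIV (\<lambda>_::nat. {0..1::real}) = C"
    by (auto simp: C_def PiE_def Pi_def)
  ultimately have "compact C"
    by (simp add: euclidean_product_topology)
  then have "seq_compact C" by (rule compact_imp_seq_compact)
  then obtain x \<sigma> where x: "x \<in> C" "strict_mono \<sigma>"
      "(\<lambda>k. e (Suc (\<sigma> k)) (q (Suc (\<sigma> k)))) \<longlonglongrightarrow> x"
    using seq_compactE[of C "\<lambda>p. e (Suc p) (q (Suc p))"] eC by (auto simp: comp_def)
  have proj: "(\<lambda>k. y k j) \<longlonglongrightarrow> z j" if "y \<longlonglongrightarrow> z" for y :: "nat \<Rightarrow> nat \<Rightarrow> real" and z j
    using that by (rule continuous_on_tendsto_compose[OF continuous_on_product_coordinates]) auto
  \<comment> \<open>As the mesh tends to 0, all corners of the chosen cells converge to the same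
    \<open>x\<close>. This is used for the corners \<open>r\<close> and \<open>s\<close>, which give
    the two inequalities between \<open>F x i\<close> and \<open>x i\<close>.\<close>
  have near: "(\<lambda>k. e (Suc (\<sigma> k)) (r k)) \<longlonglongrightarrow> x"
    if r: "\<And>k j. j < n \<Longrightarrow> q (Suc (\<sigma> k)) j \<le> r k j \<and> r k j \<le> q (Suc (\<sigma> k)) j + 1" for r
  proof -
    have "(\<lambda>k. e (Suc (\<sigma> k)) (r k) j) \<longlonglongrightarrow> x j" for j
    proof -
      have "norm (e (Suc (\<sigma> k)) (r k) j - e (Suc (\<sigma> k)) (q (Suc (\<sigma> k))) j) \<le> inverse (real (Suc (\<sigma> k)))"
        for k
      proof -
        have min1: "\<bar>min 1 b - min 1 a\<bar> \<le> c" if "a \<le> b" "b \<le> a + c" for a b c :: real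
          using that by (auto simp: min_def)
        show ?thesis
        proof (cases "j < n")
          case True
          let ?p = "real (Suc (\<sigma> k))" and ?q = "real (q (Suc (\<sigma> k)) j)"
          have "?q \<le> real (r k j)" "real (r k j) \<le> ?q + 1" using r[OF True, of k] by linarith+
          then have "?q / ?p \<le> real (r k j) / ?p" "real (r k j) / ?p \<le> (?q + 1) / ?p"
            by (intro divide_right_mono; simp)+
          then have "\<bar>min 1 (real (r k j) / ?p) - min 1 (?q / ?p)\<bar> \<le> inverse ?p"
            by (intro min1) (simp_all only: add_divide_distrib inverse_eq_divide)
          with True show ?thesis by (simp add: e_def)
        qed (simp add: e_def)
      qed
      moreover have "(\<lambda>k. inverse (real (Suc (\<sigma> k)))) \<longlonglongrightarrow> 0"
        using LIMSEQ_subseq_LIMSEQ[OF LIMSEQ_inverse_real_of_nat x(2)] by (simp add: comp_def)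
      ultimately have "(\<lambda>k. e (Suc (\<sigma> k)) (r k) j - e (Suc (\<sigma> k)) (q (Suc (\<sigma> k))) j) \<longlonglongrightarrow> 0"
        by (rule Lim_null_comparison[OF always_eventually[OF allI]])
      from tendsto_add[OF this proj[OF x(3), of j]] show ?thesis by simp
    qed
    then have "limitin (product_topology (\<lambda>_. euclidean) UNIV) (\<lambda>k. e (Suc (\<sigma> k)) (r k)) x sequentially"
      by (simp add: limitin_componentwise)
    then show ?thesis by (simp add: euclidean_product_topology)
  qed
  have "F x i = x i" if "i < n" for i
  proof (rule antisym)
    have F: "(\<lambda>k. F (y k) i) \<longlonglongrightarrow> F x i" if "y \<longlonglongrightarrow> x" for y
      using that by (rule continuous_on_tendsto_compose[OF cont[OF \<open>i < n\<close>]]) auto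
    have "\<forall>k. \<exists>r. (\<forall>j<n. q (Suc (\<sigma> k)) j \<le> r j \<and> r j \<le> q (Suc (\<sigma> k)) j + 1) \<and>
        e (Suc (\<sigma> k)) r i \<le> F (e (Suc (\<sigma> k)) r) i"
      using q[OF zero_less_Suc \<open>i < n\<close>] by blast
    from choice[OF this] obtain r where r:
        "\<And>k. (\<forall>j<n. q (Suc (\<sigma> k)) j \<le> r k j \<and> r k j \<le> q (Suc (\<sigma> k)) j + 1) \<and>
          e (Suc (\<sigma> k)) (r k) i \<le> F (e (Suc (\<sigma> k)) (r k)) i"
      by blast
    then have "(\<lambda>k. e (Suc (\<sigma> k)) (r k)) \<longlonglongrightarrow> x" by (simp add: near)
    then show "x i \<le> F x i"
      using LIMSEQ_le[OF proj F] r by blast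
    have "\<forall>k. \<exists>r. (\<forall>j<n. q (Suc (\<sigma> k)) j \<le> r j \<and> r j \<le> q (Suc (\<sigma> k)) j + 1) \<and>
        F (e (Suc (\<sigma> k)) r) i \<le> e (Suc (\<sigma> k)) r i"
      using q[OF zero_less_Suc \<open>i < n\<close>] by blast
    from choice[OF this] obtain s where s:
        "\<And>k. (\<forall>j<n. q (Suc (\<sigma> k)) j \<le> s k j \<and> s k j \<le> q (Suc (\<sigma> k)) j + 1) \<and>
          F (e (Suc (\<sigma> k)) (s k)) i \<le> e (Suc (\<sigma> k)) (s k) i"
      by blast
    then have "(\<lambda>k. e (Suc (\<sigma> k)) (s k)) \<longlonglongrightarrow> x" by (simp add: near)
    then show "F x i \<le> x i"
      using LIMSEQ_le[OF F proj] s by blast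
  qed
  with x(1) show thesis
    using that by (auto simp: C_def)
qed

section \<open>Clique rankings and fractional kernels\<close>

definition absorbs :: "'a rel \<Rightarrow> 'a set \<Rightarrow> 'a \<Rightarrow> bool" where
  "absorbs R K x \<longleftrightarrow> x \<in> K \<and> (\<forall>y\<in>K. y \<noteq> x \<longrightarrow> (y, x) \<in> R)"

text \<open>An absorbing vertex receives the top rank, and the remaining vertices are ranked
  recursively.\<close>

lemma ranking_if_absorbing:
  assumes "finite K" and "\<And>L. L \<subseteq> K \<Longrightarrow> L \<noteq> {} \<Longrightarrow> \<exists>x. absorbs R L x"
  shows "\<exists>r :: 'a \<Rightarrow> nat. inj_on r K \<and> (\<forall>u\<in>K. \<forall>v\<in>K. r u < r v \<longrightarrow> (u, v) \<in> R)"
  using assms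
proof (induction K rule: finite_psubset_induct)
  case (psubset K)
  show ?case
  proof (cases "K = {}")
    case False
    then obtain x where x: "absorbs R K x" using psubset.prems by blast
    then have "K - {x} \<subset> K" by (auto simp: absorbs_def)
    then have "\<exists>r :: 'a \<Rightarrow> nat. inj_on r (K - {x}) \<and>
        (\<forall>u\<in>K - {x}. \<forall>v\<in>K - {x}. r u < r v \<longrightarrow> (u, v) \<in> R)"
    proof (rule psubset.IH)
      fix L assume "L \<subseteq> K - {x}" "L \<noteq> {}"
      then show "\<exists>x. absorbs R L x" by (intro psubset.prems) auto
    qed
    then obtain r :: "'a \<Rightarrow> nat" where r: "inj_on r (K - {x})"
        "\<And>u v. u \<in> K - {x} \<Longrightarrow> v \<in> K - {x} \<Longrightarrow> r u < r v \<Longrightarrow> (u, v) \<in> R"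
      by blast
    \<comment> \<open>One more than the sum of all old ranks exceeds each of them.\<close>
    define r' where "r' = r(x := Suc (\<Sum>u\<in>K. r u))"
    have le: "r u < r' x" if "u \<in> K" for u
      using member_le_sum[OF that, of r] psubset.hyps by (simp add: r'_def)
    have "inj_on r' K"
    proof (rule inj_onI)
      fix u v assume uv: "u \<in> K" "v \<in> K" "r' u = r' v"
      show "u = v"
        using uv le[of u] le[of v] inj_onD[OF r(1), of u v] by (auto simp: r'_def split: if_splits)
    qed
    moreover have "(u, v) \<in> R" if "u \<in> K" "v \<in> K" "r' u < r' v" for u v
    proof (cases "v = x")
      case True
      then show ?thesis using that x by (auto simp: absorbs_def)
    next
      case False
      then have "u \<noteq> x" using that le[of v] by (auto simp: r'_def)
      then show ?thesis using that False r(2) by (simp add: r'_def)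
    qed
    ultimately show ?thesis by blast
  qed simp
qed

lemma continuous_on_Min_fun:
  fixes f :: "'i \<Rightarrow> 'x::topological_space \<Rightarrow> real"
  assumes "finite A" "A \<noteq> {}" "\<And>a. a \<in> A \<Longrightarrow> continuous_on S (f a)"
  shows "continuous_on S (\<lambda>x. MIN a\<in>A. f a x)"
  using assms
proof (induction A rule: finite_ne_induct)
  case (insert a A)
  then have "continuous_on S (\<lambda>x. min (f a x) (MIN a\<in>A. f a x))"
    by (intro continuous_on_min) auto
  then show ?case using insert by simp
qed simp

text \<open>Downward induction on \<open>m\<close>, starting above all ranks with the empty sum. By
  injectivity at most one vertex \<open>v\<close> enters at each rank; if the sum above
  \<open>v\<close> is \<open>s\<close> \<le> 1, the new sum is at most
  \<open>max s 1\<close>.\<close>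

lemma sum_prefix_le_one:
  fixes f :: "'a \<Rightarrow> real" and r :: "'a \<Rightarrow> nat"
  assumes "finite K" "inj_on r K"
    and "\<And>v. v \<in> K \<Longrightarrow> f v \<le> max 0 (1 - (\<Sum>u\<in>{u \<in> K. r v < r u}. f u))"
  shows "(\<Sum>u\<in>{u \<in> K. m \<le> r u}. f u) \<le> 1"
proof -
  define M where "M = Suc (\<Sum>u\<in>K. r u)"
  have big: "r u < M" if "u \<in> K" for u
    using member_le_sum[OF that, of r] assms(1) by (simp add: M_def)
  show ?thesis
  proof (cases "m \<le> M")
    case True
    then show ?thesis
    proof (induction m rule: inc_induct)
      case base
      have "{u \<in> K. M \<le> r u} = {}" using big by force
      then show ?case by (simp only: sum.empty zero_le_one)
    next
      case (step m)
      show ?case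
      proof (cases "\<exists>v\<in>K. r v = m")
        case True
        then obtain v where v: "v \<in> K" "r v = m" by blast
        have "{u \<in> K. m \<le> r u} = insert v {u \<in> K. m < r u}"
          using v inj_onD[OF assms(2)] by (auto simp: le_less)
        then have "(\<Sum>u\<in>{u \<in> K. m \<le> r u}. f u) = f v + (\<Sum>u\<in>{u \<in> K. m < r u}. f u)"
          using v assms(1) by simp
        then show ?thesis
          using assms(3)[OF v(1)] v(2) step.IH by (auto simp: Suc_le_eq)
      next
        case False
        then have "{u \<in> K. m \<le> r u} = {u \<in> K. Suc m \<le> r u}"
          by (auto simp: Suc_le_eq le_less)
        then show ?thesis using step.IH by simp
      qed
    qed
  next
    case False
    then have "{u \<in> K. m \<le> r u} = {}" using big by force
    then show ?thesis by (simp only: sum.empty zero_le_one)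
  qed
qed

text \<open>The minimum defining \<open>f v\<close> is attained at some \<open>K\<close>. Since
  \<open>sum_prefix_le_one\<close> bounds every upper sum by 1, the \<open>max\<close> with 0 is
  inactive there, so \<open>K\<close> is tight from \<open>v\<close> upwards. The covering
  hypothesis makes each minimum range over a nonempty family.\<close>

lemma fractional_kernel:
  fixes r :: "'a set \<Rightarrow> 'a \<Rightarrow> nat"
  assumes fin: "finite V" and sub: "\<And>K. K \<in> \<K> \<Longrightarrow> K \<subseteq> V" and cover: "V \<subseteq> \<Union>\<K>"
    and inj: "\<And>K. K \<in> \<K> \<Longrightarrow> inj_on (r K) K"
  shows "\<exists>f :: 'a \<Rightarrow> real. (\<forall>v. 0 \<le> f v) \<and> (\<forall>K\<in>\<K>. sum f K \<le> 1) \<and>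
    (\<forall>v\<in>V. \<exists>K\<in>\<K>. v \<in> K \<and> sum f {u \<in> K. r K v \<le> r K u} = 1)"
proof -
  have finK: "finite K" if "K \<in> \<K>" for K using that sub fin finite_subset by metis
  have fin\<K>: "finite \<K>"
    using sub fin by (meson PowI finite_Pow_iff finite_subset subsetI)
  \<comment> \<open>\<open>h\<close> and its inverse \<open>g\<close> number the vertices, which
    turns points of the cube into functions on \<open>V\<close>.\<close>
  obtain h where h: "bij_betw h {..<card V} V"
    using ex_bij_betw_nat_finite[OF fin] by (auto simp: atLeast0LessThan)
  define g where "g = the_inv_into {..<card V} h"
  have gh: "g (h i) = i" if "i < card V" for i
    using h that by (simp add: g_def the_inv_into_f_f bij_betw_def)
  have hg: "h (g v) = v" "g v < card V" if "v \<in> V" for v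
    using h that f_the_inv_into_f_bij_betw[of h "{..<card V}" V v]
      the_inv_into_into[of h "{..<card V}" v "{..<card V}"] by (auto simp: g_def bij_betw_def)
  define s :: "'a set \<Rightarrow> (nat \<Rightarrow> real) \<Rightarrow> 'a \<Rightarrow> real"
    where "s K x v = (\<Sum>u\<in>{u \<in> K. r K v < r K u}. x (g u))" for K x v
  define F where "F x i = (MIN K\<in>{K \<in> \<K>. h i \<in> K}. max 0 (1 - s K x (h i)))" for x i
  have ne: "{K \<in> \<K>. h i \<in> K} \<noteq> {}" if "i < card V" for i
    using h that cover by (auto simp: bij_betw_def)
  have "continuous_on UNIV (\<lambda>x. F x i)" if "i < card V" for i
    unfolding F_def s_def using ne[OF that] fin\<K>
    by (intro continuous_on_Min_fun continuous_intros) auto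
  moreover have "0 \<le> F x i \<and> F x i \<le> 1" if "i < card V" "\<And>j. 0 \<le> x j \<and> x j \<le> 1" for x i
  proof
    show "0 \<le> F x i"
      using ne[OF that(1)] fin\<K> by (simp add: F_def)
    obtain K where "K \<in> {K \<in> \<K>. h i \<in> K}" using ne[OF \<open>i < card V\<close>] by blast
    then have "F x i \<le> max 0 (1 - s K x (h i))"
      using fin\<K> by (auto simp: F_def)
    also have "\<dots> \<le> 1" using that(2) by (simp add: s_def sum_nonneg)
    finally show "F x i \<le> 1" .
  qed
  ultimately obtain x where x: "\<And>i. 0 \<le> x i \<and> x i \<le> 1" "\<And>i. i < card V \<Longrightarrow> F x i = x i"
    using brouwer_nat_cube[of "card V" F] by metis
  define f where "f v = x (g v)" for v
  have fix_eq: "f v = (MIN K\<in>{K \<in> \<K>. v \<in> K}. max 0 (1 - (\<Sum>u\<in>{u \<in> K. r K v < r K u}. f u)))"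
    if "v \<in> V" for v
    using x(2)[OF hg(2)[OF that]] hg(1)[OF that] by (simp add: F_def f_def s_def)
  have prefix: "(\<Sum>u\<in>{u \<in> K. m \<le> r K u}. f u) \<le> 1" if K: "K \<in> \<K>" for K m
  proof (rule sum_prefix_le_one[OF finK[OF K] inj[OF K]])
    fix v assume v: "v \<in> K"
    show "f v \<le> max 0 (1 - (\<Sum>u\<in>{u \<in> K. r K v < r K u}. f u))"
      using fix_eq[of v] v K sub[OF K] fin\<K> by (auto intro!: Min_le)
  qed
  show ?thesis
  proof (intro exI[of _ f] conjI allI ballI)
    show "0 \<le> f v" for v using x(1) by (simp add: f_def)
    show "sum f K \<le> 1" if "K \<in> \<K>" for K using prefix[OF that, of 0] by simp
    fix v assume v: "v \<in> V"
    let ?A = "(\<lambda>K. max 0 (1 - (\<Sum>u\<in>{u \<in> K. r K v < r K u}. f u))) ` {K \<in> \<K>. v \<in> K}"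
    have "f v \<in> ?A"
      unfolding fix_eq[OF v] using fin\<K> cover v by (intro Min_in) auto
    then obtain K where K: "K \<in> \<K>" "v \<in> K" "f v = max 0 (1 - (\<Sum>u\<in>{u \<in> K. r K v < r K u}. f u))"
      by blast
    have "f v = 1 - (\<Sum>u\<in>{u \<in> K. r K v < r K u}. f u)"
      using K(3) prefix[OF K(1), of "Suc (r K v)"] by (simp add: Suc_le_eq)
    moreover have "{u \<in> K. r K v \<le> r K u} = insert v {u \<in> K. r K v < r K u}"
      using K inj_onD[OF inj[OF K(1)]] by (auto simp: le_less)
    ultimately show "\<exists>K\<in>\<K>. v \<in> K \<and> sum f {u \<in> K. r K v \<le> r K u} = 1"
      using K finK[OF K(1)] by (intro bexI[of _ K]) auto
  qed
qed

section \<open>Rounding to integral weights\<close>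

text \<open>Dirichlet approximation with error below \<open>1 / (n + 1)\<close> for each of the
  \<open>n\<close> vertices keeps the error of every subset sum below 1. Integrality then turns the
  approximate comparisons with \<open>q\<close> into exact ones.\<close>

lemma simultaneous_rounding:
  fixes f :: "'a \<Rightarrow> real"
  assumes fin: "finite V" and nonneg: "\<And>v. 0 \<le> f v"
  shows "\<exists>(p :: 'a \<Rightarrow> nat) q. q > 0 \<and> (\<forall>K\<subseteq>V. sum f K \<le> 1 \<longrightarrow> sum p K \<le> q) \<and>
    (\<forall>K\<subseteq>V. sum f K = 1 \<longrightarrow> sum p K = q)"
proof -
  define n where "n = card V"
  obtain h where h: "bij_betw h {..<n} V"
    using ex_bij_betw_nat_finite[OF fin] by (auto simp: atLeast0LessThan n_def)
  obtain q p where qp: "0 < q" "\<And>i. i < n \<Longrightarrow> \<bar>of_int q * f (h i) - of_int (p i)\<bar> < 1 / real (Suc n)"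
    using Dirichlet_approx_simult[of "Suc n" n "\<lambda>i. f (h i)"] zero_less_Suc by metis
  define P where "P v = nat (p (the_inv_into {..<n} h v))" for v
  have close: "\<bar>of_int q * f v - real (P v)\<bar> < 1 / real (Suc n)" if "v \<in> V" for v
  proof -
    obtain i where i: "i < n" "h i = v" using h \<open>v \<in> V\<close> by (auto simp: bij_betw_def)
    \<comment> \<open>The approximated value is nonnegative and the error is below 1, so
      \<open>p i\<close> is a nonnegative integer and \<open>nat\<close> in \<open>P\<close> loses
      nothing.\<close>
    have "1 / real (Suc n) \<le> 1" by simp
    then have "- 1 < real_of_int (p i)"
      using qp(2)[OF i(1)] mult_nonneg_nonneg[of "of_int q" "f (h i)"] qp(1) nonneg
      by (smt (verit) of_int_0_le_iff)
    then have "p i \<ge> 0" by linarith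
    moreover have "the_inv_into {..<n} h v = i"
      using h i by (auto simp: bij_betw_def the_inv_into_f_f)
    ultimately show ?thesis using qp(2)[OF i(1)] i(2) by (simp add: P_def)
  qed
  have close_sum: "\<bar>of_int q * sum f K - real (sum P K)\<bar> < 1" if "K \<subseteq> V" for K
  proof -
    have "card K \<le> n" using that fin by (simp add: n_def card_mono)
    have "\<bar>of_int q * sum f K - real (sum P K)\<bar> = \<bar>\<Sum>v\<in>K. of_int q * f v - real (P v)\<bar>"
      by (simp add: sum_subtractf sum_distrib_left)
    also have "\<dots> \<le> (\<Sum>v\<in>K. \<bar>of_int q * f v - real (P v)\<bar>)"
      by (rule sum_abs)
    also have "\<dots> \<le> (\<Sum>v\<in>K. 1 / real (Suc n))"
      using close that by (intro sum_mono less_imp_le) auto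
    also have "\<dots> < 1"
      using \<open>card K \<le> n\<close> by (simp add: field_simps)
    finally show ?thesis .
  qed
  show ?thesis
  proof (intro exI[of _ P] exI[of _ "nat q"] conjI allI impI)
    show "nat q > 0" using qp(1) by simp
  next
    fix K assume K: "K \<subseteq> V"
    show "sum P K \<le> nat q" if "sum f K \<le> 1"
    proof -
      have "of_int q * sum f K \<le> of_int q" using that qp(1) by simp
      then have "real (sum P K) < of_int q + 1"
        using close_sum[OF K] by linarith
      then show ?thesis using qp(1) by linarith
    qed
    show "sum P K = nat q" if "sum f K = 1"
    proof -
      have "\<bar>of_int q - real (sum P K)\<bar> < 1" using close_sum[OF K] unfolding that by simp
      then have "q = int (sum P K)" by linarith
      then show ?thesis by (metis nat_int)
    qed
  qed
qed

section \<open>Kernels from absorbing vertices in cliques\<close>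

text \<open>Any one of the \<open>q\<close> stable sets yields a kernel. For \<open>u\<close>
  outside it, some clique is tight on its part \<open>L\<close> ranked at or above \<open>u\<close>;
  the stable set meets \<open>L\<close> in a vertex other than \<open>u\<close>, which is ranked
  higher and hence receives an arc from \<open>u\<close>.\<close>

lemma perfect_imp_kernel:
  assumes fin: "finite V" and irrefl: "\<And>v. (v, v) \<notin> R" and perf: "perfect_on (R \<union> R\<inverse>) V"
    and cliques: "\<And>K. K \<subseteq> V \<Longrightarrow> K \<noteq> {} \<Longrightarrow> clique (R \<union> R\<inverse>) K \<Longrightarrow> \<exists>x. absorbs R K x"
  shows "\<exists>S\<subseteq>V. stable_set R S \<and> (\<forall>u\<in>V - S. \<exists>v\<in>S. (u, v) \<in> R)"
proof -
  define E where "E = R \<union> R\<inverse>"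
  define \<K> where "\<K> = {K. K \<subseteq> V \<and> clique E K}"
  have "\<exists>r :: 'a \<Rightarrow> nat. inj_on r K \<and> (\<forall>u\<in>K. \<forall>v\<in>K. r u < r v \<longrightarrow> (u, v) \<in> R)" if "K \<in> \<K>" for K
  proof (rule ranking_if_absorbing)
    show "finite K" using that fin finite_subset by (auto simp: \<K>_def)
    show "\<exists>x. absorbs R L x" if "L \<subseteq> K" "L \<noteq> {}" for L
      using cliques[of L] clique_subset[of E K L] that \<open>K \<in> \<K>\<close> by (auto simp: \<K>_def E_def)
  qed
  then obtain r :: "'a set \<Rightarrow> 'a \<Rightarrow> nat" where r: "\<And>K. K \<in> \<K> \<Longrightarrow> inj_on (r K) K"
      "\<And>K u v. K \<in> \<K> \<Longrightarrow> u \<in> K \<Longrightarrow> v \<in> K \<Longrightarrow> r K u < r K v \<Longrightarrow> (u, v) \<in> R"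
    by metis
  have cover: "V \<subseteq> \<Union>\<K>"
  proof
    fix v assume "v \<in> V"
    then have "{v} \<in> \<K>" by (auto simp: \<K>_def clique_def)
    then show "v \<in> \<Union>\<K>" by blast
  qed
  have sub: "K \<subseteq> V" if "K \<in> \<K>" for K
    using that by (simp add: \<K>_def)
  obtain f :: "'a \<Rightarrow> real" where f: "\<And>v. 0 \<le> f v" "\<And>K. K \<in> \<K> \<Longrightarrow> sum f K \<le> 1"
      "\<And>v. v \<in> V \<Longrightarrow> \<exists>K\<in>\<K>. v \<in> K \<and> sum f {u \<in> K. r K v \<le> r K u} = 1"
    using fractional_kernel[OF fin sub cover r(1)] by blast
  obtain p :: "'a \<Rightarrow> nat" and q where pq: "q > 0"
      "\<And>K. K \<subseteq> V \<Longrightarrow> sum f K \<le> 1 \<Longrightarrow> sum p K \<le> q"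
      "\<And>K. K \<subseteq> V \<Longrightarrow> sum f K = 1 \<Longrightarrow> sum p K = q"
    using simultaneous_rounding[OF fin, of f] f(1) by blast
  have "\<exists>As. length As = q \<and> (\<forall>A\<in>set As. stable_set E A) \<and>
      (\<forall>v\<in>V. length (filter (\<lambda>A. v \<in> A) As) = p v)"
    using fin perf irrefl pq(2) f(2) unfolding E_def[symmetric]
    by (intro perfect_weighted_coloring) (auto simp: E_def \<K>_def)
  then obtain As where As: "length As = q" "\<And>A. A \<in> set As \<Longrightarrow> stable_set E A"
      "\<And>v. v \<in> V \<Longrightarrow> length (filter (\<lambda>A. v \<in> A) As) = p v"
    by blast
  define A where "A = hd As"
  have A: "A \<in> set As" using pq(1) As(1) by (auto simp: A_def)
  \<comment> \<open>The sets of the weighted colouring need not lie inside \<open>V\<close>, hence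
    the intersection.\<close>
  have "\<exists>v\<in>A \<inter> V. (u, v) \<in> R" if u: "u \<in> V - A \<inter> V" for u
  proof -
    obtain K where K: "K \<in> \<K>" "u \<in> K" "sum f {w \<in> K. r K u \<le> r K w} = 1"
      using f(3) u by blast
    define L where "L = {w \<in> K. r K u \<le> r K w}"
    have L: "L \<subseteq> V" "clique E L"
      using K clique_subset[of E K L] by (auto simp: \<K>_def L_def)
    have "sum p L = q" using pq(3)[OF L(1)] K(3) by (simp add: L_def)
    then have "(\<Sum>v\<in>L. length (filter (\<lambda>A. v \<in> A) As)) = length As"
      using As(1,3) L(1) by (metis (no_types, lifting) subsetD sum.cong)
    then have "card (L \<inter> A) = 1"
      using tight_clique_meets_stable[OF _ L(2) As(2) _ A] L(1) fin finite_subset by blast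
    then obtain s where s: "s \<in> L" "s \<in> A" by (metis IntE card_1_singletonE insertI1)
    have "s \<noteq> u" using s L u by blast
    then have "r K u < r K s"
      using s K inj_onD[OF r(1)[OF K(1)]] by (force simp: L_def le_less)
    then have "(u, s) \<in> R" using r(2)[OF K(1,2)] s(1) by (simp add: L_def)
    then show ?thesis using s L(1) by blast
  qed
  moreover have "stable_set R (A \<inter> V)"
    using As(2)[OF A] by (auto simp: stable_set_def E_def)
  ultimately show ?thesis by blast
qed

section \<open>Critical cliques\<close>

definition kernel_on :: "'a rel \<Rightarrow> 'a set \<Rightarrow> bool" where
  "kernel_on R W \<longleftrightarrow> (\<exists>S\<subseteq>W. stable_set R S \<and> (\<forall>u\<in>W - S. \<exists>v\<in>S. (u, v) \<in> R))"

text \<open>For \<open>n\<close> \<ge> 3 this is an isomorphism onto the circulant digraph with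
  jumps \<open>jumps_one_pm n\<close>: the only nonzero residue missing from these jumps is
  -1.\<close>

definition cyclic_labelling :: "'a rel \<Rightarrow> 'a set \<Rightarrow> nat \<Rightarrow> ('a \<Rightarrow> int) \<Rightarrow> bool" where
  "cyclic_labelling R V n g \<longleftrightarrow> bij_betw g V {0..<int n} \<and>
     (\<forall>u\<in>V. \<forall>v\<in>V. (u, v) \<in> R \<longleftrightarrow> g u \<noteq> g v \<and> g u \<noteq> (g v + 1) mod int n)"

lemma kernel_on_if_absorbs:
  assumes "absorbs R W x" "(x, x) \<notin> R"
  shows "kernel_on R W"
  using assms unfolding kernel_on_def absorbs_def stable_set_def
  by (intro exI[of _ "{x}"]) auto

text \<open>A stable subset of a clique has at most one vertex, and the empty set does not absorb a
  nonempty \<open>W\<close>.\<close>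

lemma absorbs_if_kernel_on:
  assumes "clique (R \<union> R\<inverse>) W" "kernel_on R W" "W \<noteq> {}"
  obtains x where "absorbs R W x"
proof -
  obtain S where S: "S \<subseteq> W" "stable_set R S" "\<And>u. u \<in> W - S \<Longrightarrow> \<exists>v\<in>S. (u, v) \<in> R"
    using assms(2) by (auto simp: kernel_on_def)
  then obtain x where x: "x \<in> S" using assms(3) by blast
  have "y = x" if "y \<in> S" for y
    using S(1,2) that x assms(1) unfolding clique_def stable_set_def by blast
  then have "absorbs R W x" unfolding absorbs_def using x S by blast
  then show thesis by (rule that)
qed

text \<open>The successor \<open>N x\<close> is the only other vertex without an arc to
  \<open>x\<close>, so \<open>x\<close> absorbs \<open>W\<close> as soon as \<open>N x\<close> is
  outside \<open>W\<close>. Every nonempty proper subset has such an \<open>x\<close>, whereas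
  \<open>V\<close> is closed under \<open>N\<close>.\<close>

lemma cyclic_labelling_imp_critical:
  assumes n: "n \<ge> 3" and lab: "cyclic_labelling R V n g"
  shows "\<not> kernel_on R V \<and> (\<forall>W\<subset>V. kernel_on R W)"
proof -
  have bij: "bij_betw g V {0..<int n}"
    and R: "\<And>u v. u \<in> V \<Longrightarrow> v \<in> V \<Longrightarrow> (u, v) \<in> R \<longleftrightarrow> g u \<noteq> g v \<and> g u \<noteq> (g v + 1) mod int n"
    using lab by (auto simp: cyclic_labelling_def)
  have inj: "g u = g v \<longleftrightarrow> u = v" if "u \<in> V" "v \<in> V" for u v
    using bij that by (auto simp: bij_betw_def inj_on_eq_iff)
  have range: "0 \<le> g v" "g v < int n" if "v \<in> V" for v
    using bij that by (auto simp: bij_betw_def)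
  have "\<exists>w\<in>V. g w = (g v + 1) mod int n" for v
  proof -
    have "(g v + 1) mod int n \<in> g ` V" using n bij by (simp add: bij_betw_def)
    then show ?thesis by fastforce
  qed
  then obtain N where N: "\<And>v. N v \<in> V" "\<And>v. g (N v) = (g v + 1) mod int n" by metis
  have step: "(x + 1) mod int n = (if x + 1 = int n then 0 else x + 1)" if "0 \<le> x" "x < int n" for x
    using that by auto
  \<comment> \<open>That two steps never return to \<open>v\<close> uses \<open>n\<close> \<ge> 3;
    it guarantees at least one arc between any two vertices.\<close>
  have Nne: "N v \<noteq> v" "N (N v) \<noteq> v" if "v \<in> V" for v
  proof -
    have "g (N v) = (if g v + 1 = int n then 0 else g v + 1)"
      "g (N (N v)) = (if g (N v) + 1 = int n then 0 else g (N v) + 1)"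
      using N(2) step range that N(1) by metis+
    then have "g (N v) \<noteq> g v" "g (N (N v)) \<noteq> g v"
      using n range[OF that] by (auto split: if_splits)
    then show "N v \<noteq> v" "N (N v) \<noteq> v" by auto
  qed
  have R': "(u, v) \<in> R \<longleftrightarrow> u \<noteq> v \<and> u \<noteq> N v" if "u \<in> V" "v \<in> V" for u v
    using R[OF that] inj[OF that] inj[OF that(1) N(1)] N(2) by metis
  have "V \<noteq> {}" using bij n by (auto simp: bij_betw_def)
  have clq: "clique (R \<union> R\<inverse>) V"
    unfolding clique_def
  proof (intro ballI impI)
    fix u v assume uv: "u \<in> V" "v \<in> V" "u \<noteq> v"
    then have "(u, v) \<in> R \<or> (v, u) \<in> R"
      using R'[of u v] R'[of v u] Nne(2)[of v] by metis
    then show "(u, v) \<in> R \<union> R\<inverse>" by blast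
  qed
  have "\<not> absorbs R V x" for x
    unfolding absorbs_def using R'[of "N x" x] N(1) Nne(1)[of x] by blast
  then have "\<not> kernel_on R V"
    using absorbs_if_kernel_on[OF clq _ \<open>V \<noteq> {}\<close>] by blast
  moreover have "kernel_on R W" if W: "W \<subset> V" for W
  proof (cases "W = {}")
    case True
    then show ?thesis by (auto simp: kernel_on_def stable_set_def)
  next
    case False
    have "\<exists>x\<in>W. N x \<notin> W"
    proof (rule ccontr)
      assume *: "\<not> ?thesis"
      obtain w where w: "w \<in> W" using False by blast
      have orbit: "\<exists>x\<in>W. g x = (g w + int k) mod int n" for k
      proof (induction k)
        case 0
        show ?case using w W range[of w] by (intro bexI[of _ w]) auto
      next
        case (Suc k)
        then obtain x where "x \<in> W" "g x = (g w + int k) mod int n" by blast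
        then show ?case
          using * N(2)[of x] by (intro bexI[of _ "N x"]) (auto simp: mod_simps algebra_simps)
      qed
      have "v \<in> W" if "v \<in> V" for v
      proof -
        \<comment> \<open>Adding \<open>int n\<close> keeps the argument of \<open>nat\<close>
          nonnegative without changing the residue.\<close>
        have "(g w + int (nat (g v - g w + int n))) mod int n = g v"
          using range[OF that] range[of w] w W by auto
        with orbit[of "nat (g v - g w + int n)"] obtain x where "x \<in> W" "g x = g v" by metis
        with inj[of x v] W \<open>v \<in> V\<close> show ?thesis by auto
      qed
      with W show False by blast
    qed
    then obtain x where x: "x \<in> W" "N x \<notin> W" by blast
    then have "absorbs R W x" unfolding absorbs_def using R' W by (metis psubsetD)
    moreover have "(x, x) \<notin> R" using R'[of x x] x(1) W by auto
    ultimately show ?thesis by (rule kernel_on_if_absorbs)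
  qed
  ultimately show ?thesis by blast
qed

text \<open>
  Choosing for every \<open>v\<close> a vertex \<open>N v\<close> without an arc to \<open>v\<close>, any nonempty set closed under \<open>N\<close>
  has no kernel, hence is everything. So \<open>N\<close> is a cyclic permutation and the choice of \<open>N\<close> was unique.
\<close>

lemma critical_clique_imp_cyclic_labelling:
  assumes fin: "finite V" and irrefl: "\<And>v. (v, v) \<notin> R" and clq: "clique (R \<union> R\<inverse>) V"
    and nker: "\<not> kernel_on R V" and crit: "\<And>W. W \<subset> V \<Longrightarrow> kernel_on R W"
  shows "\<exists>n\<ge>3. \<exists>g. cyclic_labelling R V n g"
proof -
  define valid where "valid N \<longleftrightarrow> (\<forall>v\<in>V. N v \<in> V \<and> N v \<noteq> v \<and> (N v, v) \<notin> R)" for N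
  have "\<exists>u\<in>V. u \<noteq> v \<and> (u, v) \<notin> R" if "v \<in> V" for v
    using kernel_on_if_absorbs[of R V v] irrefl nker that by (auto simp: absorbs_def)
  then obtain N where validN: "valid N" unfolding valid_def by metis
  then have N: "\<And>v. v \<in> V \<Longrightarrow> N v \<in> V" "\<And>v. v \<in> V \<Longrightarrow> N v \<noteq> v" "\<And>v. v \<in> V \<Longrightarrow> (N v, v) \<notin> R"
    by (auto simp: valid_def)
  \<comment> \<open>This is stated for all valid choices, as it is applied to \<open>N\<close> and
    also to \<open>N\<close> altered at one vertex.\<close>
  have closed: "W = V" if W: "valid M" "W \<subseteq> V" "W \<noteq> {}" "\<And>w. w \<in> W \<Longrightarrow> M w \<in> W" for M W
  proof (rule ccontr)
    assume "W \<noteq> V"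
    then have "kernel_on R W" using crit W(2) by blast
    then obtain x where x: "absorbs R W x"
      using absorbs_if_kernel_on[OF clique_subset[OF clq W(2)] _ W(3)] by blast
    then show False
      using W(1,2) W(4)[of x] by (auto simp: absorbs_def valid_def)
  qed
  have "V \<noteq> {}" using nker by (auto simp: kernel_on_def stable_set_def)
  then obtain v0 where v0: "v0 \<in> V" by blast
  have "N ` V = V"
    using closed[OF validN, of "N ` V"] N(1) \<open>V \<noteq> {}\<close> by auto
  then have injN: "inj_on N V" by (simp add: fin finite_surj_inj)
  have R: "(u, v) \<in> R \<longleftrightarrow> u \<noteq> v \<and> u \<noteq> N v" if uv: "u \<in> V" "v \<in> V" for u v
  proof (rule ccontr)
    assume "\<not> ?thesis"
    then have u: "u \<noteq> v" "u \<noteq> N v" "(u, v) \<notin> R" using irrefl N(3)[OF uv(2)] by auto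
    \<comment> \<open>If \<open>v\<close> had a second candidate \<open>u\<close>, redirecting
      \<open>v\<close> to \<open>u\<close> would leave \<open>N v\<close> without a preimage, by
      injectivity, so \<open>V - {N v}\<close> would be closed.\<close>
    have "valid (N(v := u))" using validN u uv by (auto simp: valid_def)
    moreover have "(N(v := u)) w \<in> V - {N v}" if "w \<in> V - {N v}" for w
      using that u uv N(1) inj_onD[OF injN, of w v] by auto
    ultimately have "V - {N v} = V" using u uv by (intro closed[of "N(v := u)"]) auto
    then show False using N(1)[OF uv(2)] by blast
  qed
  define n where "n = card V"
  define h where "h k = (N ^^ k) v0" for k :: nat
  have hSuc: "h (Suc k) = N (h k)" for k by (simp add: h_def)
  have hV: "h k \<in> V" for k
    by (induction k) (use v0 N(1) in \<open>auto simp: h_def\<close>)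
  \<comment> \<open>The orbit segment between two equal values is closed under \<open>N\<close>,
    hence all of \<open>V\<close>, so a repetition takes at least \<open>n\<close> steps.\<close>
  have repeat: "n \<le> j - i" if "i < j" "h i = h j" for i j
  proof -
    have "h ` {i..<j} = V"
    proof (rule closed[OF validN])
      fix w assume "w \<in> h ` {i..<j}"
      then obtain k where k: "k \<in> {i..<j}" "w = h k" by blast
      then have "N w = h (if Suc k = j then i else Suc k)" using that by (simp flip: hSuc)
      with k that(1) show "N w \<in> h ` {i..<j}" by auto
    qed (use that hV in auto)
    then show ?thesis using card_image_le[of "{i..<j}" h] by (simp add: n_def)
  qed
  have inj_h: "inj_on h {..<n}"
  proof (rule inj_onI)
    fix i j assume "i \<in> {..<n}" "j \<in> {..<n}" "h i = h j"
    then show "i = j" using repeat[of i j] repeat[of j i] by (cases i j rule: linorder_cases) auto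
  qed
  have bij_h: "bij_betw h {..<n} V"
    using inj_h hV fin card_subset_eq[of V "h ` {..<n}"]
    by (auto simp: bij_betw_def card_image n_def)
  have npos: "n > 0" using fin \<open>V \<noteq> {}\<close> by (simp add: n_def card_gt_0_iff)
  have hn: "h n = h 0"
  proof -
    obtain i where i: "i < n" "h n = h i"
      using bij_h hV[of n] unfolding bij_betw_def by (metis imageE lessThan_iff)
    then show ?thesis using repeat[of i n] by (cases i) auto
  qed
  have "n \<noteq> 1" using hn hSuc[of 0] N(2)[OF hV[of 0]] by auto
  moreover have "n \<noteq> 2"
  \<comment> \<open>Two vertices that are each other's image under \<open>N\<close> would have no
    arc between them, against \<open>V\<close> being a clique.\<close>
  proof
    assume "n = 2"
    then have "N (N (h 0)) = h 0" using hn hSuc by (simp add: numeral_2_eq_2)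
    then have "(N (h 0), h 0) \<notin> R" "(h 0, N (h 0)) \<notin> R" using R hV N(1) by metis+
    then show False using clq N(2)[OF hV[of 0]] hV[of 0] N(1) by (auto simp: clique_def)
  qed
  ultimately have n3: "n \<ge> 3" using npos by linarith
  define g where "g v = int (the_inv_into {..<n} h v)" for v
  have gh: "g (h i) = int i" if "i < n" for i
    using inj_h that by (simp add: g_def the_inv_into_f_f)
  have ex: "\<exists>i<n. v = h i" if "v \<in> V" for v
    using bij_h that by (auto simp: bij_betw_def)
  have "bij_betw int {..<n} {0..<int n}"
    by (auto simp: bij_betw_def image_int_atLeastLessThan simp flip: atLeast0LessThan)
  from bij_betw_trans[OF bij_betw_the_inv_into[OF bij_h] this]
  have bij_g: "bij_betw g V {0..<int n}"
    by (simp add: g_def[abs_def] comp_def)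
  have gN: "g (N v) = (g v + 1) mod int n" if v: "v \<in> V" for v
  proof -
    obtain i where i: "i < n" "v = h i" using ex[OF v] by blast
    show ?thesis
    proof (cases "Suc i = n")
      case True
      then have "N v = h 0" using i hn by (simp flip: hSuc)
      moreover have "int i + 1 = int n" using True by linarith
      ultimately show ?thesis using i gh npos by simp
    next
      case False
      then have "N v = h (Suc i)" "Suc i < n" using i by (simp_all add: hSuc)
      then show ?thesis using i gh by simp
    qed
  qed
  have "(u, v) \<in> R \<longleftrightarrow> g u \<noteq> g v \<and> g u \<noteq> (g v + 1) mod int n" if uv: "u \<in> V" "v \<in> V" for u v
    unfolding R[OF uv] gN[OF uv(2), symmetric]
    using bij_g uv N(1)[OF uv(2)] by (auto simp: bij_betw_def inj_on_eq_iff)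
  with bij_g n3 show ?thesis unfolding cyclic_labelling_def by blast
qed

text \<open>Without a kernel, some nonempty clique has no absorbing vertex and hence no kernel
  itself; criticality forces this clique to be all of \<open>V\<close>.\<close>

lemma perfect_critical_iff_cyclic_labelling:
  assumes fin: "finite V" and irrefl: "\<And>v. (v, v) \<notin> R" and perf: "perfect_on (R \<union> R\<inverse>) V"
  shows "(\<not> kernel_on R V \<and> (\<forall>W\<subset>V. kernel_on R W)) \<longleftrightarrow> (\<exists>n\<ge>3. \<exists>g. cyclic_labelling R V n g)"
proof
  assume *: "\<not> kernel_on R V \<and> (\<forall>W\<subset>V. kernel_on R W)"
  then obtain K where K: "K \<subseteq> V" "K \<noteq> {}" "clique (R \<union> R\<inverse>) K" "\<nexists>x. absorbs R K x"
    using perfect_imp_kernel[OF fin irrefl perf] unfolding kernel_on_def by metis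
  then have "\<not> kernel_on R K" using absorbs_if_kernel_on by metis
  with * K(1) have "K = V" by blast
  with K * show "\<exists>n\<ge>3. \<exists>g. cyclic_labelling R V n g"
    by (intro critical_clique_imp_cyclic_labelling[OF fin irrefl]) auto
next
  assume "\<exists>n\<ge>3. \<exists>g. cyclic_labelling R V n g"
  then show "\<not> kernel_on R V \<and> (\<forall>W\<subset>V. kernel_on R W)"
    using cyclic_labelling_imp_critical by blast
qed

section \<open>Digraphs\<close>

lemma (in wf_digraph) induced_subgraph_iff_induce:
  "induced_subgraph H G \<longleftrightarrow> (\<exists>W\<subseteq>verts G. H = G \<restriction> W)"
proof
  assume H: "induced_subgraph H G"
  then have "H = G \<restriction> verts H"
    by (intro pre_digraph.equality) (auto simp: induced_subgraph_def subgraph_def compatible_def)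
  moreover have "verts H \<subseteq> verts G" using H by (auto simp: induced_subgraph_def subgraph_def)
  ultimately show "\<exists>W\<subseteq>verts G. H = G \<restriction> W" by blast
qed (auto intro: induced_induce)

lemma dominates_induce_iff: "u \<rightarrow>\<^bsub>G \<restriction> W\<^esub> v \<longleftrightarrow> u \<rightarrow>\<^bsub>G\<^esub> v \<and> u \<in> W \<and> v \<in> W"
  by (auto simp: arcs_ends_conv)

lemma has_kernel_induce_iff: "has_kernel (D \<restriction> W) \<longleftrightarrow> kernel_on (arcs_ends D) W"
proof -
  have "is_kernel (D \<restriction> W) S \<longleftrightarrow>
      S \<subseteq> W \<and> stable_set (arcs_ends D) S \<and> (\<forall>u\<in>W - S. \<exists>v\<in>S. u \<rightarrow>\<^bsub>D\<^esub> v)" for S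
  proof (cases "S \<subseteq> W")
    case True
    then have "independent_set (D \<restriction> W) S \<longleftrightarrow> stable_set (arcs_ends D) S"
      unfolding independent_set_def stable_set_def dominates_induce_iff induce_subgraph_verts by blast
    moreover have "absorbent_set (D \<restriction> W) S \<longleftrightarrow> (\<forall>u\<in>W - S. \<exists>v\<in>S. u \<rightarrow>\<^bsub>D\<^esub> v)"
      using True unfolding absorbent_set_def dominates_induce_iff induce_subgraph_verts
      by (auto simp: subset_iff)
    ultimately show ?thesis using True by (simp add: is_kernel_def)
  qed (simp add: is_kernel_def independent_set_def)
  then show ?thesis by (simp add: has_kernel_def kernel_on_def)
qed

lemma (in wf_digraph) induce_verts_self: "G \<restriction> verts G = G"
  by (intro pre_digraph.equality) auto

lemma (in wf_digraph) cki_digraph_iff: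
  "cki_digraph G \<longleftrightarrow>
     \<not> kernel_on (arcs_ends G) (verts G) \<and> (\<forall>W\<subset>verts G. kernel_on (arcs_ends G) W)"
proof -
  have "G \<restriction> W \<noteq> G \<longleftrightarrow> W \<noteq> verts G" for W
    by (metis induce_subgraph_verts induce_verts_self)
  then show ?thesis
    unfolding cki_digraph_def induced_subgraph_iff_induce psubset_eq
    by (metis has_kernel_induce_iff induce_verts_self)
qed

lemma (in digraph) perfect_graph_imp_perfect_on:
  assumes "perfect_graph G"
  shows "perfect_on (arcs_ends G) (verts G)"
  unfolding perfect_on_def
proof (intro allI impI)
  fix W k
  assume W: "W \<subseteq> verts G" and k: "\<forall>K\<subseteq>W. clique (arcs_ends G) K \<longrightarrow> card K \<le> k"
  let ?H = "G \<restriction> W"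
  have finW: "finite W" using finite_subset[OF W finite_verts] .
  have cl: "is_clique ?H K \<longleftrightarrow> K \<subseteq> W \<and> clique (arcs_ends G) K" for K
    unfolding is_clique_def clique_def dominates_induce_iff induce_subgraph_verts by blast
  then have cliques: "{K. is_clique ?H K} = {K. K \<subseteq> W \<and> clique (arcs_ends G) K}" by simp
  \<comment> \<open>The empty clique keeps the set under \<open>Max\<close> nonempty.\<close>
  have "clique (arcs_ends G) {}" by (simp add: clique_def)
  then have "clique_number ?H \<le> k"
    unfolding clique_number_def cliques using k finW by (subst Max_le_iff) auto
  then have chi: "chromatic_number ?H \<le> k"
    using assms induced_induce[OF W] by (simp add: perfect_graph_def)
  \<comment> \<open>An injective colouring shows that some number of colours suffices, so the
    \<open>LEAST\<close> in \<open>chromatic_number\<close> is attained.\<close>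
  obtain c0 where c0: "bij_betw c0 W {0..<card W}"
    using ex_bij_betw_finite_nat[OF finW] by blast
  have "is_coloring ?H (card W) c0"
    unfolding is_coloring_def dominates_induce_iff induce_subgraph_verts
  proof (intro conjI allI impI ballI)
    show "c0 v < card W" if "v \<in> W" for v using bij_betwE[OF c0] that by simp
    show "c0 u \<noteq> c0 v" if "u \<rightarrow>\<^bsub>G\<^esub> v \<and> u \<in> W \<and> v \<in> W" for u v
      using c0 that adj_not_same by (metis bij_betw_imp_inj_on inj_on_eq_iff)
  qed
  then have "\<exists>c. is_coloring ?H (chromatic_number ?H) c"
    unfolding chromatic_number_def
    by (rule LeastI[where P = "\<lambda>k. \<exists>c. is_coloring ?H k c", OF exI])
  then obtain c where c: "is_coloring ?H (chromatic_number ?H) c" by blast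
  have "c v < k" if "v \<in> W" for v
    using c chi that by (auto simp: is_coloring_def intro: less_le_trans)
  moreover have "c u \<noteq> c v" if "u \<in> W" "v \<in> W" "u \<rightarrow>\<^bsub>G\<^esub> v" for u v
    using c that by (simp add: is_coloring_def dominates_induce_iff)
  ultimately show "\<exists>c. (\<forall>v\<in>W. c v < k) \<and>
      (\<forall>u\<in>W. \<forall>v\<in>W. (u, v) \<in> arcs_ends G \<longrightarrow> c u \<noteq> (c v :: nat))"
    by blast
qed

section \<open>Isomorphism with circulant digraphs\<close>

text \<open>Without parallel arcs an arc is determined by its ends, so a vertex bijection respecting
  adjacency extends to the arcs by sending each arc to the pair of images of its ends.\<close>

lemma digraph_iso_with_proj_iff:
  assumes "digraph D"
  shows "digraph_iso D (with_proj C) \<longleftrightarrow>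
    (\<exists>g. bij_betw g (verts D) (pverts C) \<and> parcs C = (\<lambda>(u, v). (g u, g v)) ` arcs_ends D)"
proof -
  interpret digraph D by fact
  show ?thesis
  proof
    assume "digraph_iso D (with_proj C)"
    then obtain f where f: "digraph_isomorphism f" "with_proj C = app_iso f D"
      by (auto simp: digraph_iso_def)
    have "pverts C = iso_verts f ` verts D"
      using arg_cong[OF f(2), of verts] by simp
    moreover have "parcs C = (\<lambda>(u, v). (iso_verts f u, iso_verts f v)) ` arcs_ends D"
      using arg_cong[OF f(2), of arcs_ends] arcs_ends_app_iso_eq[OF f(1)] by simp
    ultimately show "\<exists>g. bij_betw g (verts D) (pverts C) \<and> parcs C = (\<lambda>(u, v). (g u, g v)) ` arcs_ends D"
      using digraph_isomorphism_inj_on_verts[OF f(1)] by (auto simp: bij_betw_def)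
  next
    assume "\<exists>g. bij_betw g (verts D) (pverts C) \<and> parcs C = (\<lambda>(u, v). (g u, g v)) ` arcs_ends D"
    then obtain g where g: "bij_betw g (verts D) (pverts C)"
      "parcs C = (\<lambda>(u, v). (g u, g v)) ` arcs_ends D" by blast
    define f where "f = \<lparr>iso_verts = g, iso_arcs = (\<lambda>a. (g (tail D a), g (head D a))),
      iso_head = snd, iso_tail = fst\<rparr>"
    have "inj_on (\<lambda>a. (g (tail D a), g (head D a))) (arcs D)"
    proof (rule inj_onI)
      fix a b assume ab: "a \<in> arcs D" "b \<in> arcs D"
        "(g (tail D a), g (head D a)) = (g (tail D b), g (head D b))"
      then have "arc_to_ends D a = arc_to_ends D b"
        using g(1) by (auto simp: arc_to_ends_def bij_betw_def dest: inj_onD)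
      with ab no_multi_arcs show "a = b" by blast
    qed
    then have "digraph_isomorphism f"
      using g(1) wf_digraph by (auto simp: digraph_isomorphism_def f_def bij_betw_def)
    moreover have "with_proj C = app_iso f D"
      using g by (auto simp: app_iso_def f_def with_proj_def bij_betw_def arcs_ends_conv image_image)
    ultimately show "digraph_iso D (with_proj C)" by (auto simp: digraph_iso_def)
  qed
qed

lemma parcs_circulant_jumps:
  assumes n: "n \<ge> 3"
  shows "parcs (circulant n (jumps_one_pm n)) =
    {(i, j). i \<in> {0..<int n} \<and> j \<in> {0..<int n} \<and> i \<noteq> j \<and> i \<noteq> (j + 1) mod int n}"
proof -
  have "(\<exists>k\<in>jumps_one_pm n. [j - i = k] (mod int n)) \<longleftrightarrow> i \<noteq> j \<and> i \<noteq> (j + 1) mod int n"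
    if ij: "i \<in> {0..<int n}" "j \<in> {0..<int n}" for i j
  proof
    assume "\<exists>k\<in>jumps_one_pm n. [j - i = k] (mod int n)"
    then obtain k where k: "k \<in> jumps_one_pm n" "int n dvd (j - i - k)"
      by (auto simp: cong_iff_dvd_diff)
    have k_ne: "\<not> int n dvd k" "\<not> int n dvd (k + 1)"
    proof -
      have small: "\<not> int n dvd m" if "0 < \<bar>m\<bar>" "\<bar>m\<bar> < int n" for m
        using that zdvd_not_zless[of "\<bar>m\<bar>" "int n"] by simp
      have "0 < \<bar>k\<bar> \<and> \<bar>k\<bar> < int n \<and> 0 < \<bar>k + 1\<bar> \<and> \<bar>k + 1\<bar> < int n"
        using k(1) n by (auto simp: jumps_one_pm_def)
      then show "\<not> int n dvd k" "\<not> int n dvd (k + 1)"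
        using small by blast+
    qed
    have "i \<noteq> j" using k(2) k_ne(1) by auto
    moreover have "i \<noteq> (j + 1) mod int n"
    proof
      assume "i = (j + 1) mod int n"
      then have "int n dvd (j + 1 - i)" by (simp add: mod_eq_dvd_iff[symmetric])
      from dvd_diff[OF this k(2)] have "int n dvd (k + 1)" by (simp add: algebra_simps)
      with k_ne(2) show False by blast
    qed
    ultimately show "i \<noteq> j \<and> i \<noteq> (j + 1) mod int n" by blast
  next
    assume ne: "i \<noteq> j \<and> i \<noteq> (j + 1) mod int n"
    have "\<exists>k\<in>jumps_one_pm n. j - i - k \<in> {0, int n, - int n}"
    proof -
      \<comment> \<open>\<open>d\<close> is the residue of \<open>j - i\<close> in the range 1 to
        \<open>n - 1\<close>, and the excluded pairs are those with \<open>d = n - 1\<close>. For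
        \<open>d\<close> \<noteq> 1, either \<open>d\<close> or \<open>n - d\<close> lies between 2
        and \<open>n div 2\<close>.\<close>
      define d where "d = (if i < j then j - i else j - i + int n)"
      have "d = 1 \<or> 2 \<le> d \<and> d \<le> int n - 2"
        using ij ne by (cases "j + 1 = int n") (auto simp: d_def)
      then consider "d = 1" | "2 \<le> d" "d \<le> int (n div 2)" | "2 \<le> int n - d" "int n - d \<le> int (n div 2)"
        by linarith
      then show ?thesis
      proof cases
        case 1
        then show ?thesis by (intro bexI[of _ 1]) (auto simp: d_def jumps_one_pm_def split: if_splits)
      next
        case 2
        then show ?thesis by (intro bexI[of _ d]) (auto simp: d_def jumps_one_pm_def split: if_splits)
      next
        case 3
        then have "int n - d \<in> {2..int (n div 2)}" by simp
        then have "- (int n - d) \<in> jumps_one_pm n" unfolding jumps_one_pm_def by blast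
        then show ?thesis
          by (rule bexI[rotated]) (simp add: d_def)
      qed
    qed
    then obtain k where k: "k \<in> jumps_one_pm n" "j - i - k \<in> {0, int n, - int n}" by blast
    have "int n dvd (j - i - k)" using k(2) by auto
    with k(1) show "\<exists>k\<in>jumps_one_pm n. [j - i = k] (mod int n)"
      unfolding cong_iff_dvd_diff by blast
  qed
  then show ?thesis by (auto simp: circulant_def)
qed

text \<open>As \<open>3 div 2\<close> is 1, the range of \<open>k\<close> is empty and only the jump
  1 remains; the triangle is thus the case \<open>n = 3\<close> of the family.\<close>

lemma directed_cycle_3_eq: "directed_cycle 3 = circulant 3 (jumps_one_pm 3)"
  by (simp add: directed_cycle_def jumps_one_pm_def)

lemma digraph_iso_circulant_jumps_iff:
  assumes D: "digraph D" and n: "n \<ge> 3"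
  shows "digraph_iso D (with_proj (circulant n (jumps_one_pm n))) \<longleftrightarrow>
    (\<exists>g. cyclic_labelling (arcs_ends D) (verts D) n g)"
proof -
  interpret digraph D by fact
  have arcs_iff: "parcs (circulant n (jumps_one_pm n)) = (\<lambda>(u, v). (g u, g v)) ` arcs_ends D \<longleftrightarrow>
      (\<forall>u\<in>verts D. \<forall>v\<in>verts D. u \<rightarrow>\<^bsub>D\<^esub> v \<longleftrightarrow> g u \<noteq> g v \<and> g u \<noteq> (g v + 1) mod int n)"
    (is "?P = ?A \<longleftrightarrow> ?R") if g: "bij_betw g (verts D) {0..<int n}" for g
  proof -
    \<comment> \<open>Both arc sets consist of pairs of \<open>g\<close>-images of vertices, so
      their equality can be tested on such pairs.\<close>
    have eq_iff_on_superset: "X = Y \<longleftrightarrow> (\<forall>e\<in>Z. e \<in> Y \<longleftrightarrow> e \<in> X)" if "X \<subseteq> Z" "Y \<subseteq> Z"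
      for X Y Z :: "(int \<times> int) set"
      using that by blast
    have P: "(g u, g v) \<in> ?P \<longleftrightarrow> g u \<noteq> g v \<and> g u \<noteq> (g v + 1) mod int n"
      if "u \<in> verts D" "v \<in> verts D" for u v
      using g that unfolding parcs_circulant_jumps[OF n] by (auto simp: bij_betw_def)
    have A: "(g u, g v) \<in> ?A \<longleftrightarrow> u \<rightarrow>\<^bsub>D\<^esub> v" if "u \<in> verts D" "v \<in> verts D" for u v
    proof
      assume "(g u, g v) \<in> ?A"
      then obtain u' v' where uv: "u' \<rightarrow>\<^bsub>D\<^esub> v'" "g u = g u'" "g v = g v'" by auto
      with g that adj_in_verts[OF uv(1)] show "u \<rightarrow>\<^bsub>D\<^esub> v"
        by (metis bij_betw_def inj_onD)
    qed force
    have "?P \<subseteq> g ` verts D \<times> g ` verts D"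
      using g unfolding parcs_circulant_jumps[OF n] by (auto simp: bij_betw_def)
    moreover have "?A \<subseteq> g ` verts D \<times> g ` verts D"
      using adj_in_verts by auto
    ultimately have "?P = ?A \<longleftrightarrow> (\<forall>e\<in>g ` verts D \<times> g ` verts D. e \<in> ?A \<longleftrightarrow> e \<in> ?P)"
      by (intro eq_iff_on_superset)
    also have "\<dots> \<longleftrightarrow> (\<forall>u\<in>verts D. \<forall>v\<in>verts D. (g u, g v) \<in> ?A \<longleftrightarrow> (g u, g v) \<in> ?P)"
      by (simp only: split_paired_Ball_Sigma ball_simps)
    finally show ?thesis using A P by simp
  qed
  have "pverts (circulant n (jumps_one_pm n)) = {0..<int n}" by (simp add: circulant_def)
  then show ?thesis
    unfolding digraph_iso_with_proj_iff[OF D] cyclic_labelling_def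
    by (simp only:) (intro ex_cong1 conj_cong refl arcs_iff)
qed

theorem theorem5:
  fixes D :: "('a, 'b) pre_digraph"
  assumes "digraph D"
    and "perfect_graph (with_proj (mk_symmetric D))"
  shows "cki_digraph D \<longleftrightarrow>
    digraph_iso D (with_proj (directed_cycle 3)) \<or>
    (\<exists>n\<ge>4. digraph_iso D (with_proj (circulant n (jumps_one_pm n))))"
proof -
  interpret digraph D by fact
  interpret G: pair_digraph "mk_symmetric D" by (rule digraph_mk_symmetric)
  have "arcs_ends (with_proj (mk_symmetric D)) = arcs_ends D \<union> (arcs_ends D)\<inverse>"
    by (auto simp: parcs_mk_symmetric arcs_ends_conv)
  then have perf: "perfect_on (arcs_ends D \<union> (arcs_ends D)\<inverse>) (verts D)"
    using digraph.perfect_graph_imp_perfect_on[OF G.digraph_axioms assms(2)] by simp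
  have "cki_digraph D \<longleftrightarrow> (\<exists>n\<ge>3. \<exists>g. cyclic_labelling (arcs_ends D) (verts D) n g)"
    unfolding cki_digraph_iff
    by (rule perfect_critical_iff_cyclic_labelling[OF finite_verts _ perf]) (use adj_not_same in blast)
  also have "\<dots> \<longleftrightarrow> (\<exists>n\<ge>3. digraph_iso D (with_proj (circulant n (jumps_one_pm n))))"
    using digraph_iso_circulant_jumps_iff[OF assms(1)] by blast
  also have "\<dots> \<longleftrightarrow> digraph_iso D (with_proj (circulant 3 (jumps_one_pm 3))) \<or>
      (\<exists>n\<ge>4. digraph_iso D (with_proj (circulant n (jumps_one_pm n))))"
    using le_eq_less_or_eq[of 3] by (auto simp: Suc_le_eq numeral_eq_Suc)
  finally show ?thesis unfolding directed_cycle_3_eq .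
qed

end
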